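(* Let $\rho>0$, $\bar\lambda\in\mathbb{R}^n$ and $\bar x\in X$ be given, and consider the problem $$(\mathrm{P}_y)\qquad \min_{y\in Y}\ L_\rho(\bar x,y,\bar\lambda).$$ Let $w=\bar x-\frac1\rho\bar\lambda$, let $r_i=\min_{a_i\le y_i\le b_i}(y_i-w_i)^2$ and $v_i=r_i-w_i^2$ for $i=1,\dots,n$, and assume the indices are ordered so that $v_1\le v_2\le\dots\le v_n$. Let $\bar z_i=1$ if $i\le K$ and $v_i\le 0$, and $\bar z_i=0$ otherwise. Then $\bar y$ defined by $$\bar y_i=\bar z_i\cdot\min\{b_i,\max\{w_i,a_i\}\},\qquad i=1,\dots,n,$$ is an optimal solution of $(\mathrm{P}_y)$.
   Context: $f:\mathbb{R}^n\to\mathbb{R}$ is a continuously differentiable convex function; $X\subseteq\mathbb{R}^n$ is a closed convex set with nonempty interior; $0<K<n$; $0<a_i<b_i$ for $i=1,\dots,n$. $\|y\|_0$ is the number of nonzero entries of $y$ and $\|\cdot\|$ is the Euclidean norm. The set $Y$ and the augmented Lagrangian are $$Y=\{y\in\mathbb{R}^n:\ \|y\|_0\le K,\ y_i\in\{0\}\cup[a_i,b_i],\ i=1,\dots,n\},$$ $$L_\rho(x,y,\lambda)=f(x)+\lambda^T(y-x)+\frac{\rho}{2}\|y-x\|^2.$$ *)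

theory Defs
  imports "HOL-Analysis.Analysis"
begin

definition cont_differentiable :: "(real ^ 'n \<Rightarrow> real) \<Rightarrow> bool" where
  "cont_differentiable f \<longleftrightarrow> (\<exists>g. (\<forall>x. GDERIV f x :> g x) \<and> continuous_on UNIV g)"

definition norm0 :: "real ^ 'n \<Rightarrow> nat" where
  "norm0 y = card {i. y $ i \<noteq> 0}"

definition sparse_box :: "nat \<Rightarrow> real ^ 'n \<Rightarrow> real ^ 'n \<Rightarrow> (real ^ 'n) set" where
  "sparse_box K a b = {y. norm0 y \<le> K \<and> (\<forall>i. y $ i \<in> {0} \<union> {a $ i..b $ i})}"

definition aug_lagrangian ::
  "(real ^ 'n \<Rightarrow> real) \<Rightarrow> real \<Rightarrow> real ^ 'n \<Rightarrow> real ^ 'n \<Rightarrow> real ^ 'n \<Rightarrow> real" where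
  "aug_lagrangian f \<rho> x y l = f x + l \<bullet> (y - x) + \<rho> / 2 * (norm (y - x))\<^sup>2"

text \<open>
  The minimum of the squared distance from \<open>c\<close> to a point of \<open>[lo, hi]\<close>. It is written as an
  infimum because \<^const>\<open>Min\<close> is meaningful only for finite sets; the lemma below shows that for
  \<open>lo \<le> hi\<close> the infimum is attained.
\<close>
definition min_sq_dist :: "real \<Rightarrow> real \<Rightarrow> real \<Rightarrow> real" where
  "min_sq_dist lo hi c = (INF t\<in>{lo..hi}. (t - c)\<^sup>2)"

lemma min_sq_dist_attained:
  assumes "lo \<le> hi"
  shows "\<exists>t\<in>{lo..hi}. min_sq_dist lo hi c = (t - c)\<^sup>2 \<and> (\<forall>s\<in>{lo..hi}. (t - c)\<^sup>2 \<le> (s - c)\<^sup>2)"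
proof -
  have "\<exists>t\<in>{lo..hi}. \<forall>s\<in>{lo..hi}. (t - c)\<^sup>2 \<le> (s - c)\<^sup>2"
    using assms by (intro continuous_attains_inf) (auto intro!: continuous_intros)
  then obtain t where t: "t \<in> {lo..hi}" "\<forall>s\<in>{lo..hi}. (t - c)\<^sup>2 \<le> (s - c)\<^sup>2"
    by blast
  have "min_sq_dist lo hi c = (t - c)\<^sup>2"
    unfolding min_sq_dist_def using t by (intro cInf_eq_minimum) auto
  with t show ?thesis by blast
qed

end

theory Submission
  imports Defs
begin

text \<open>
  Completing the square turns the objective into a constant plus
  \<open>\<rho>/2 * \<Sum>i. (y i - w i)\<^sup>2\<close>. A feasible \<open>y\<close> with support \<open>S\<close> costs at least
  \<open>\<Sum>i. (w i)\<^sup>2\<close> plus \<open>\<Sum>i\<in>S. v i\<close>, with equality for \<open>ybar\<close>, so it remains to minimise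
  \<open>\<Sum>i\<in>S. v i\<close> over the sets \<open>S\<close> with at most \<open>K\<close> elements. The set of those of the first
  \<open>K\<close> indices with \<open>v i \<le> 0\<close> is optimal, with multiplier \<open>min 0 (v k)\<close> for the constraint
  \<open>card S \<le> K\<close>, where \<open>k\<close> is the \<open>K\<close>-th index.
\<close>

lemma min_sq_dist_le:
  assumes "s \<in> {lo..hi}"
  shows "min_sq_dist lo hi c \<le> (s - c)\<^sup>2"
  unfolding min_sq_dist_def using assms
  by (intro cINF_lower bdd_belowI2[where m = 0]) auto

text \<open>Clamping projects \<open>c\<close> onto the interval, and the projection is the nearest
  point.\<close>

lemma min_sq_dist_eq_clamp:
  assumes "lo \<le> hi"
  shows "min_sq_dist lo hi c = (min hi (max c lo) - c)\<^sup>2"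
  unfolding min_sq_dist_def
proof (rule cInf_eq_minimum)
  fix d
  assume "d \<in> (\<lambda>t. (t - c)\<^sup>2) ` {lo..hi}"
  then obtain s where s: "s \<in> {lo..hi}" "d = (s - c)\<^sup>2"
    by blast
  have "\<bar>min hi (max c lo) - c\<bar> \<le> \<bar>s - c\<bar>"
    using s(1) by (auto simp: min_def max_def)
  then show "(min hi (max c lo) - c)\<^sup>2 \<le> d"
    by (simp add: s(2) abs_le_square_iff)
qed (use assms in auto)

lemma aug_lagrangian_complete_square:
  fixes x y l :: "real ^ 'n"
  assumes "\<rho> > 0"
  shows "aug_lagrangian f \<rho> x y l =
    f x - (norm l)\<^sup>2 / (2 * \<rho>) + \<rho> / 2 * (\<Sum>i\<in>UNIV. (y $ i - (x - (1 / \<rho>) *\<^sub>R l) $ i)\<^sup>2)"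
proof -
  \<comment> \<open>The cross term of this squared norm, scaled by \<open>\<rho> / 2\<close>, is the
    linear term of the Lagrangian.\<close>
  have "(\<Sum>i\<in>UNIV. (y $ i - (x - (1 / \<rho>) *\<^sub>R l) $ i)\<^sup>2) = (norm ((y - x) + (1 / \<rho>) *\<^sub>R l))\<^sup>2"
    unfolding power2_norm_eq_inner inner_vec_def
    by (intro sum.cong refl) (simp add: power2_eq_square algebra_simps)
  also have "\<dots> = (norm (y - x))\<^sup>2 + 2 / \<rho> * (l \<bullet> (y - x)) + (norm l)\<^sup>2 / \<rho>\<^sup>2"
    by (simp only: power2_norm_eq_inner)
      (simp add: inner_add_left inner_add_right inner_commute power2_eq_square)
  finally have "(\<Sum>i\<in>UNIV. (y $ i - (x - (1 / \<rho>) *\<^sub>R l) $ i)\<^sup>2) =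
    (norm (y - x))\<^sup>2 + 2 / \<rho> * (l \<bullet> (y - x)) + (norm l)\<^sup>2 / \<rho>\<^sup>2" .
  with assms show ?thesis
    by (simp only: aug_lagrangian_def) (simp add: field_simps power2_eq_square)
qed

text \<open>Weak duality with multiplier \<open>t\<close>: after subtracting \<open>t\<close> from
  every value, the elements of \<open>T\<close> contribute at most 0 and those of \<open>S\<close>
  outside \<open>T\<close> at least 0. The hypothesis \<open>card\<close> pays for the subtracted
  copies of \<open>t\<close>.\<close>

lemma sum_le_sum_threshold:
  fixes v :: "'a \<Rightarrow> real"
  assumes "finite S" and "finite T"
    and below: "\<And>i. i \<in> T \<Longrightarrow> v i \<le> t"
    and above: "\<And>i. i \<in> S \<Longrightarrow> i \<notin> T \<Longrightarrow> t \<le> v i"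
    and card: "t * card T \<le> t * card S"
  shows "sum v T \<le> sum v S"
proof -
  \<comment> \<open>Dropping nonpositive terms raises the sum; \<open>sum_mono2\<close> wants
    nonnegative terms, hence the negated summand \<open>t - v i\<close>.\<close>
  have "(\<Sum>i\<in>T. v i - t) \<le> (\<Sum>i\<in>S \<inter> T. v i - t)"
    using sum_mono2[of T "S \<inter> T" "\<lambda>i. t - v i"] assms(2) below
    by (auto simp: sum_subtractf)
  also have "\<dots> \<le> (\<Sum>i\<in>S. v i - t)"
    using above by (intro sum_mono2) (auto simp: \<open>finite S\<close>)
  finally show ?thesis
    using card by (simp add: sum_subtractf mult.commute)
qed

lemma sum_first_nonpos_le:
  fixes v :: "'a \<Rightarrow> real" and idx :: "'a \<Rightarrow> nat"
  assumes "finite A" and bij: "bij_betw idx A {1..n}"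
    and mono: "\<And>i j. i \<in> A \<Longrightarrow> j \<in> A \<Longrightarrow> idx i \<le> idx j \<Longrightarrow> v i \<le> v j"
    and "0 < K" and "K \<le> n" and "S \<subseteq> A" and "card S \<le> K"
  shows "sum v {i \<in> A. idx i \<le> K \<and> v i \<le> 0} \<le> sum v S"
proof -
  let ?T = "{i \<in> A. idx i \<le> K \<and> v i \<le> 0}"
  have "K \<in> idx ` A"
    using bij assms(4,5) by (auto simp: bij_betw_def)
  then obtain k where k: "k \<in> A" "idx k = K"
    by blast
  \<comment> \<open>Membership in the candidate set gives both \<open>v i \<le> 0\<close> and
    \<open>v i \<le> v k\<close>; an index outside it has \<open>v i > 0\<close> or comes after
    \<open>k\<close>. So \<open>t\<close> separates the two.\<close>
  define t where "t = min 0 (v k)"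
  show ?thesis
  proof (rule sum_le_sum_threshold)
    show "finite S" "finite ?T"
      using assms(1,6) finite_subset by auto
    show "v i \<le> t" if "i \<in> ?T" for i
      using that mono[of i k] k by (auto simp: t_def)
    show "t \<le> v i" if "i \<in> S" "i \<notin> ?T" for i
      using that mono[of k i] k assms(6) by (fastforce simp: t_def)
    show "t * card ?T \<le> t * card S"
    \<comment> \<open>Complementary slackness: either \<open>t = 0\<close>, or the first
      \<open>K\<close> values are all negative, so that the candidate set has exactly
      \<open>K \<ge> card S\<close> elements and the negative \<open>t\<close> reverses the
      inequality.\<close>
    proof (cases "v k < 0")
      case True
      have "?T = {i \<in> A. idx i \<le> K}"
        using True mono[of _ k] k by fastforce
      moreover have "idx ` {i \<in> A. idx i \<le> K} = {1..K}"
      proof -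
        have "idx ` {i \<in> A. idx i \<le> K} = idx ` A \<inter> {..K}"
          by auto
        then show ?thesis
          using bij assms(5) by (auto simp: bij_betw_def)
      qed
      moreover have "inj_on idx {i \<in> A. idx i \<le> K}"
        using bij by (auto simp: bij_betw_def inj_on_def)
      ultimately have "card ?T = K"
        using card_image by fastforce
      then show ?thesis
        using True assms(7) by (simp add: t_def)
    qed (simp add: t_def)
  qed
qed

lemma card_le_if_bij_betw_atLeastAtMost:
  assumes "bij_betw idx A {1..n}" and "T \<subseteq> {i \<in> A. idx i \<le> K}"
  shows "card T \<le> K"
proof -
  have T: "i \<in> A" "idx i \<le> K" if "i \<in> T" for i
    using assms(2) that by auto
  have "inj_on idx T"
    using assms(1) T(1) by (auto simp: bij_betw_def inj_on_def)
  moreover have "idx ` T \<subseteq> {1..K}"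
    using bij_betwE[OF assms(1)] T by fastforce
  ultimately have "card T \<le> card {1..K}"
    by (intro card_inj_on_le) auto
  then show ?thesis
    by simp
qed

theorem theorem4p2:
  fixes f :: "real ^ 'n \<Rightarrow> real"
    and X :: "(real ^ 'n) set"
    and K :: nat
    and a b :: "real ^ 'n"
    and \<rho> :: real
    and lbar xbar w r v zbar ybar :: "real ^ 'n"
    and idx :: "'n \<Rightarrow> nat"
  assumes "cont_differentiable f" and "convex_on UNIV f"
    and "closed X" and "convex X" and "interior X \<noteq> {}"
    and "0 < K" and "K < CARD('n)"
    and "\<And>i. 0 < a $ i" and "\<And>i. a $ i < b $ i"
    and "\<rho> > 0" and "xbar \<in> X"
    and "w = xbar - (1 / \<rho>) *\<^sub>R lbar"
    and "\<And>i. r $ i = min_sq_dist (a $ i) (b $ i) (w $ i)"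
    and "\<And>i. v $ i = r $ i - (w $ i)\<^sup>2"
    and "bij_betw idx UNIV {1..CARD('n)}"
    and "\<And>i j. idx i \<le> idx j \<Longrightarrow> v $ i \<le> v $ j"
    and "\<And>i. zbar $ i = (if idx i \<le> K \<and> v $ i \<le> 0 then 1 else 0)"
    and "\<And>i. ybar $ i = zbar $ i * min (b $ i) (max (w $ i) (a $ i))"
  shows "is_arg_min (\<lambda>y. aug_lagrangian f \<rho> xbar y lbar) (\<lambda>y. y \<in> sparse_box K a b) ybar"
proof -
  define T where "T = {i. idx i \<le> K \<and> v $ i \<le> 0}"
  define c where "c i = min (b $ i) (max (w $ i) (a $ i))" for i
  \<comment> \<open>Since \<open>c i \<ge> a $ i > 0\<close>, the support of \<open>ybar\<close> is
    exactly \<open>T\<close>.\<close>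
  have c: "c i \<in> {a $ i..b $ i}" "c i \<noteq> 0" for i
    using assms(8)[of i] assms(9)[of i] by (auto simp: c_def min_def max_def)
  have ybar: "ybar $ i = (if i \<in> T then c i else 0)" for i
    by (simp add: assms(17,18) T_def c_def)
  \<comment> \<open>So \<open>v $ i\<close> is the change in cost when coordinate \<open>i\<close>
    moves from 0 to its best nonzero value.\<close>
  have v_eq: "v $ i = (c i - w $ i)\<^sup>2 - (w $ i)\<^sup>2" for i
    using assms(9)[of i] by (simp add: assms(13,14) min_sq_dist_eq_clamp c_def)
  have supp: "{i. ybar $ i \<noteq> 0} = T"
    using c(2) by (auto simp: ybar)
  have "card T \<le> K"
    by (rule card_le_if_bij_betw_atLeastAtMost[OF assms(15)]) (auto simp: T_def)
  then have feasible: "ybar \<in> sparse_box K a b"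
    using c by (auto simp: sparse_box_def norm0_def supp ybar)
  have split: "(\<Sum>i\<in>UNIV. (w $ i)\<^sup>2 + (if i \<in> S then v $ i else 0)) =
      (\<Sum>i\<in>UNIV. (w $ i)\<^sup>2) + (\<Sum>i\<in>S. v $ i)" for S
    by (simp add: sum.distrib flip: sum.inter_restrict)
  have le: "(\<Sum>i\<in>UNIV. (ybar $ i - w $ i)\<^sup>2) \<le> (\<Sum>i\<in>UNIV. (y $ i - w $ i)\<^sup>2)"
    if y: "y \<in> sparse_box K a b" for y
  proof -
    let ?S = "{i. y $ i \<noteq> 0}"
    have "(\<Sum>i\<in>UNIV. (ybar $ i - w $ i)\<^sup>2) = (\<Sum>i\<in>UNIV. (w $ i)\<^sup>2 + (if i \<in> T then v $ i else 0))"
      by (intro sum.cong) (auto simp: ybar v_eq)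
    also have "\<dots> = (\<Sum>i\<in>UNIV. (w $ i)\<^sup>2) + (\<Sum>i\<in>T. v $ i)"
      by (rule split)
    also have "(\<Sum>i\<in>T. v $ i) \<le> (\<Sum>i\<in>?S. v $ i)"
      using sum_first_nonpos_le[OF _ assms(15), of "\<lambda>i. v $ i" K ?S] assms(6,7,16) y
      by (auto simp: T_def sparse_box_def norm0_def)
    also have "(\<Sum>i\<in>UNIV. (w $ i)\<^sup>2) + (\<Sum>i\<in>?S. v $ i) =
        (\<Sum>i\<in>UNIV. (w $ i)\<^sup>2 + (if i \<in> ?S then v $ i else 0))"
      by (rule split[symmetric])
    \<comment> \<open>A zero coordinate costs exactly \<open>(w $ i)\<^sup>2\<close>; a nonzero one
      lies in \<open>[a $ i, b $ i]\<close> and costs at least \<open>r $ i\<close>.\<close>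
    also have "\<dots> \<le> (\<Sum>i\<in>UNIV. (y $ i - w $ i)\<^sup>2)"
    proof (rule sum_mono)
      fix i
      show "(w $ i)\<^sup>2 + (if i \<in> ?S then v $ i else 0) \<le> (y $ i - w $ i)\<^sup>2"
      proof (cases "y $ i = 0")
        case False
        then have "y $ i \<in> {a $ i..b $ i}"
          using y by (auto simp: sparse_box_def)
        then show ?thesis
          using False by (simp add: assms(13,14) min_sq_dist_le)
      qed simp
    qed
    finally show ?thesis
      by simp
  qed
  have "aug_lagrangian f \<rho> xbar ybar lbar \<le> aug_lagrangian f \<rho> xbar y lbar"
    if "y \<in> sparse_box K a b" for y
    using le[OF that] \<open>\<rho> > 0\<close> unfolding aug_lagrangian_complete_square[OF \<open>\<rho> > 0\<close>] assms(12)
    by (intro add_left_mono mult_left_mono) auto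
  with feasible show ?thesis
    by (auto simp: is_arg_min_def not_less)
qed

end
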